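(* Let $\pi = (4, 6, 8, 5, 11, 7, 2, 9, 10, 3, 1) \in S_{11}$. Then $\pi$ reaches a periodic point of $SC_{231}$, equivalently an element of $\mathrm{Av}_{11}(132, 231)$, after exactly $19$ applications of $SC_{231}$: $SC_{231}^{18}(\pi) \notin \mathrm{Av}_{11}(132,231)$ and $SC_{231}^{19}(\pi) \in \mathrm{Av}_{11}(132,231)$. In particular, it is not true that $SC_{231}^{2n-4}(\rho) \in \mathrm{Av}_n(132,231)$ for every $n \geq 3$ and every $\rho \in S_n$.
   Context: $S_n$ is the set of permutations of $\{1,\dots,n\}$, written as sequences. A permutation avoids the (classical) pattern $\tau$ if it has no subsequence (not necessarily in consecutive positions) in the same relative order as $\tau$; $\mathrm{Av}_n(132,231)$ is the set of permutations in $S_n$ avoiding both $132$ and $231$. The periodic points of $SC_{231}$ on $S_n$ are exactly the elements of $\mathrm{Av}_n(132,231)$. The map $SC_{231} : S_n \to S_n$ is defined by the following procedure on an input permutation, with an initially empty stack and an initially empty output. "Push" removes the first remaining entry of the input and places it on top of the stack; "pop" removes the top entry of the stack and appends it to the end of the output. At each step, if input entries remain and pushing the next input entry would not create, in the stack read from top to bottom, three consecutive entries in the same relative order as $231$, push; otherwise, pop. The procedure ends when the input and the stack are empty, and the value of the map is the resulting output. $SC_{231}^m$ denotes the $m$-fold iterate. *)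

theory Defs
  imports "HOL-Library.Sublist" "HOL-Combinatorics.Multiset_Permutations"
begin

abbreviation Perms :: "nat \<Rightarrow> nat list set" where
  "Perms n \<equiv> permutations_of_set {1..n}"

definition same_order :: "nat list \<Rightarrow> nat list \<Rightarrow> bool" where
  "same_order xs ys \<longleftrightarrow> length xs = length ys \<and>
     (\<forall>i<length xs. \<forall>j<length xs. xs ! i < xs ! j \<longleftrightarrow> ys ! i < ys ! j)"

definition contains_pattern :: "nat list \<Rightarrow> nat list \<Rightarrow> bool" where
  "contains_pattern xs p \<longleftrightarrow> (\<exists>zs. subseq zs xs \<and> same_order zs p)"

text \<open>The library's \<^const>\<open>sublist\<close> means a block of consecutive entries.\<close>

definition contains_consecutive :: "nat list \<Rightarrow> nat list \<Rightarrow> bool" where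
  "contains_consecutive xs p \<longleftrightarrow> (\<exists>zs. sublist zs xs \<and> same_order zs p)"

definition Av :: "nat \<Rightarrow> nat list set \<Rightarrow> nat list set" where
  "Av n P = {xs \<in> Perms n. \<forall>p\<in>P. \<not> contains_pattern xs p}"

text \<open>
  The arguments of \<open>stack_run\<close> are the remaining input and the current stack, listed from top to
  bottom; the value is the part of the output still to be produced. Pushing onto an empty stack
  cannot create three consecutive entries, so the third equation always pushes. The stack never
  contains a consecutive 231, so a push creates one iff the enlarged stack contains one.
\<close>

function stack_run :: "nat list \<Rightarrow> nat list \<Rightarrow> nat list" where
  "stack_run [] [] = []"
| "stack_run [] (y # st) = y # stack_run [] st"
| "stack_run (x # xs) [] = stack_run xs [x]"
| "stack_run (x # xs) (y # st) =
     (if \<not> contains_consecutive (x # y # st) [2, 3, 1]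
      then stack_run xs (x # y # st)
      else y # stack_run (x # xs) st)"
  by pat_completeness auto
termination
  by (relation "measure (\<lambda>(xs, st). 2 * length xs + length st)") auto

definition SC231 :: "nat list \<Rightarrow> nat list" where
  "SC231 xs = stack_run xs []"

definition periodic_point :: "('a \<Rightarrow> 'a) \<Rightarrow> 'a \<Rightarrow> bool" where
  "periodic_point f x \<longleftrightarrow> (\<exists>k>0. (f ^^ k) x = x)"

end

theory Submission
  imports Defs
begin

text \<open>
  An entry that is larger than some entry before it and some entry after it is the 3 of a pattern
  132 or 231, so for permutations avoiding both patterns means having no such peak. On a
  peak-free permutation the stack never has to pop early, because a consecutive 231 in the stack is
  a peak; the map is therefore list reversal there. Reversal preserves peak-freeness, so the set of
  avoiders is closed under the map and each of its elements has period dividing 2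
  (\<open>SC231_Av\<close>, \<open>periodic_point_Av\<close>). Conversely, a periodic point some iterate of which is an
  avoider lies on the forward orbit of that iterate and so is an avoider itself
  (\<open>periodic_point_absorbed\<close>).

  Since avoiders stay avoiders, the arrival time of \<open>\<pi>\<close> is decided by the two iterates 18 and 19
  alone: the former contains the peak 9 11 10, the latter decreases to 1 and then increases.
  As \<open>18 = 2 * 11 - 4\<close>, this refutes the bound \<open>2 * n - 4\<close>.
\<close>

section \<open>Peaks\<close>

definition peak_free :: "'a::linorder list \<Rightarrow> bool" where
  "peak_free xs \<longleftrightarrow> (\<forall>a b c. subseq [a, b, c] xs \<longrightarrow> \<not> (a < b \<and> c < b))"

lemma subseq_rev: "subseq xs ys \<Longrightarrow> subseq (rev xs) (rev ys)"
proof (induction rule: list_emb.induct)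
  case (list_emb_Cons2 x y xs ys)
  then show ?case by simp
qed (auto intro: subseq_rev_drop_many)

lemma sorted_wrt_subseq:
  assumes "subseq xs ys" "sorted_wrt P ys"
  shows "sorted_wrt P xs"
  using assms
proof (induction rule: list_emb.induct)
  case (list_emb_Cons2 x y xs ys)
  moreover have "set xs \<subseteq> set ys"
    using list_emb_Cons2.hyps(2) by (auto elim: list_emb_set)
  ultimately show ?case by auto
qed auto

lemma peak_free_rev:
  assumes "peak_free xs"
  shows "peak_free (rev xs)"
  unfolding peak_free_def
proof (intro allI impI)
  fix a b c assume "subseq [a, b, c] (rev xs)"
  then have "subseq [c, b, a] xs"
    using subseq_rev[of "[a, b, c]" "rev xs"] by simp
  then show "\<not> (a < b \<and> c < b)"
    using assms by (auto simp: peak_free_def)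
qed

lemma peak_free_decreasing_increasing:
  assumes "sorted_wrt (>) ds" "sorted_wrt (<) us"
  shows "peak_free (ds @ us)"
  unfolding peak_free_def
proof (intro allI impI)
  fix a b c assume "subseq [a, b, c] (ds @ us)"
  then obtain l r where lr: "[a, b, c] = l @ r" "subseq l ds" "subseq r us"
    by (auto elim: subseq_appendE)
  have dec: "sorted_wrt (>) l" and inc: "sorted_wrt (<) r"
    using lr assms by (auto intro: sorted_wrt_subseq)
  \<comment> \<open>Either \<open>a\<close> and \<open>b\<close> both come from the decreasing part or \<open>b\<close> and \<open>c\<close> from the increasing one.\<close>
  show "\<not> (a < b \<and> c < b)"
    using lr(1) dec inc by (auto simp: Cons_eq_append_conv)
qed

lemma same_order_triple:
  "same_order zs [p, q, r] \<longleftrightarrow> (\<exists>a b c. zs = [a, b, c] \<and> same_order [a, b, c] [p, q, r])"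
  by (auto simp: same_order_def length_Suc_conv eval_nat_numeral)

lemma same_order_132: "same_order zs [1, 3, 2] \<longleftrightarrow> (\<exists>a b c. zs = [a, b, c] \<and> a < c \<and> c < b)"
  by (subst same_order_triple) (auto simp: same_order_def All_less_Suc2 numeral_3_eq_3)

lemma same_order_231: "same_order zs [2, 3, 1] \<longleftrightarrow> (\<exists>a b c. zs = [a, b, c] \<and> c < a \<and> a < b)"
  by (subst same_order_triple) (auto simp: same_order_def All_less_Suc2 numeral_3_eq_3)

text \<open>Distinctness excludes peaks whose two lower entries are equal, which match neither pattern.\<close>

lemma peak_free_iff_avoids:
  assumes "distinct xs"
  shows "peak_free xs \<longleftrightarrow> \<not> contains_pattern xs [1, 3, 2] \<and> \<not> contains_pattern xs [2, 3, 1]"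
proof -
  have "a \<noteq> c" if "subseq [a, b, c] xs" for a b c
    using that assms by (auto simp: subseq_conv_nths dest: arg_cong[of _ _ distinct])
  then show ?thesis
    unfolding peak_free_def contains_pattern_def same_order_132 same_order_231
    by (metis less_trans linorder_neqE_nat)
qed

lemma Av_132_231_iff:
  "xs \<in> Av n {[1, 3, 2], [2, 3, 1]} \<longleftrightarrow> xs \<in> Perms n \<and> peak_free xs"
  by (auto simp: Av_def permutations_of_set_def peak_free_iff_avoids)

section \<open>The map on avoiders\<close>

text \<open>If no pop is forced, the input ends up reversed on the stack, which is then emptied from the top.\<close>

lemma stack_run_push_all:
  assumes "\<not> contains_consecutive (rev xs @ st) [2, 3, 1]"
  shows "stack_run xs st = rev xs @ st"
  using assms
proof (induction xs arbitrary: st)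
  case Nil
  show ?case by (induction st) auto
next
  case (Cons x xs)
  \<comment> \<open>Each intermediate stack is a suffix of the final one.\<close>
  have "\<not> contains_consecutive (x # st) [2, 3, 1]"
    using Cons.prems unfolding contains_consecutive_def
    by (auto intro: sublist_order.order.trans[OF _ sublist_append_leftI])
  then show ?case using Cons by (cases st) auto
qed

lemma SC231_peak_free:
  assumes "peak_free xs"
  shows "SC231 xs = rev xs"
proof -
  have "\<not> contains_consecutive (rev xs) [2, 3, 1]"
    using peak_free_rev[OF assms]
    unfolding contains_consecutive_def same_order_231 peak_free_def
    by (metis less_trans sublist_imp_subseq)
  then show ?thesis using stack_run_push_all[of xs "[]"] by (simp add: SC231_def)
qed

lemma SC231_Av:
  assumes "xs \<in> Av n {[1, 3, 2], [2, 3, 1]}"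
  shows "SC231 xs \<in> Av n {[1, 3, 2], [2, 3, 1]}"
  using assms unfolding Av_132_231_iff
  by (auto simp: SC231_peak_free peak_free_rev permutations_of_set_def)

lemma periodic_point_Av:
  assumes "xs \<in> Av n {[1, 3, 2], [2, 3, 1]}"
  shows "periodic_point SC231 xs"
proof -
  have "(SC231 ^^ 2) xs = xs"
    using assms unfolding Av_132_231_iff
    by (simp add: SC231_peak_free peak_free_rev numeral_2_eq_2)
  then show ?thesis unfolding periodic_point_def by (intro exI[of _ 2]) simp
qed

section \<open>Iterating into a closed set\<close>

lemma funpow_closed_mono:
  assumes closed: "\<And>y. y \<in> A \<Longrightarrow> f y \<in> A" and "(f ^^ m) x \<in> A" "m \<le> n"
  shows "(f ^^ n) x \<in> A"
  using assms(3,2) by (induction rule: dec_induct) (auto intro: closed)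

lemma periodic_point_absorbed:
  assumes closed: "\<And>y. y \<in> A \<Longrightarrow> f y \<in> A"
    and "(f ^^ m) x \<in> A" "periodic_point f x"
  shows "x \<in> A"
proof -
  obtain k where k: "k > 0" "(f ^^ k) x = x"
    using assms(3) by (auto simp: periodic_point_def)
  \<comment> \<open>Going round the cycle \<open>m\<close> times takes at least \<open>m\<close> steps, hence ends inside \<open>A\<close>.\<close>
  have "(f ^^ (k * m)) x = x"
    using k(2) by (induction m) (auto simp: funpow_add)
  moreover have "(f ^^ (k * m)) x \<in> A"
    using k(1) by (intro funpow_closed_mono[OF closed assms(2)]) auto
  ultimately show ?thesis by simp
qed

section \<open>The orbit of the given permutation\<close>

lemma contains_consecutive_231:
  "contains_consecutive xs [2, 3, 1] \<longleftrightarrow> (\<exists>a b c. sublist [a, b, c] xs \<and> c < a \<and> a < b)"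
  unfolding contains_consecutive_def same_order_231 by blast

text \<open>
  Together with the equations of \<open>stack_run\<close>, these rewrite rules make the map computable by
  simplification. Numerals have to be kept intact, so that the pattern stays syntactically
  \<open>[2, 3, 1]\<close> and the rules match.
\<close>

lemma contains_consecutive_231_rec:
  "\<not> contains_consecutive [x, y] [2, 3, 1]"
  "contains_consecutive (x # y # z # st) [2, 3, 1]
     \<longleftrightarrow> z < x \<and> x < y \<or> contains_consecutive (y # z # st) [2, 3, 1]"
  unfolding contains_consecutive_231 by (auto simp: sublist_Cons_right)

lemmas SC231_eval = SC231_def contains_consecutive_231_rec

lemma funpow_numeral_apply:
  "(f ^^ numeral k) x = (f ^^ pred_numeral k) (f x)"
  "(f ^^ 1) x = f x"
  by (simp_all only: numeral_eq_Suc One_nat_def funpow.simps(1) funpow_Suc_right o_apply id_apply)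

lemma SC231_pow_18:
  "(SC231 ^^ 18) [4, 6, 8, 5, 11, 7, 2, 9, 10, 3, 1] = [8, 7, 4, 3, 2, 1, 5, 6, 9, 11, 10]"
  by (simp add: funpow_numeral_apply SC231_eval del: One_nat_def)

lemma SC231_step_19:
  "SC231 [8, 7, 4, 3, 2, 1, 5, 6, 9, 11, 10] = [11, 10, 9, 6, 5, 1, 2, 3, 4, 7, 8]"
  by (simp add: SC231_eval del: One_nat_def)

theorem mainTheorem2:
  fixes \<pi> :: "nat list"
  assumes "\<pi> = [4, 6, 8, 5, 11, 7, 2, 9, 10, 3, 1]"
  shows "\<pi> \<in> Perms 11
    \<and> (\<forall>m<19. \<not> periodic_point SC231 ((SC231 ^^ m) \<pi>)
                \<and> (SC231 ^^ m) \<pi> \<notin> Av 11 {[1, 3, 2], [2, 3, 1]})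
    \<and> (SC231 ^^ 18) \<pi> \<notin> Av 11 {[1, 3, 2], [2, 3, 1]}
    \<and> (SC231 ^^ 19) \<pi> \<in> Av 11 {[1, 3, 2], [2, 3, 1]}
    \<and> periodic_point SC231 ((SC231 ^^ 19) \<pi>)
    \<and> \<not> (\<forall>n\<ge>3. \<forall>\<rho>\<in>Perms n.
            (SC231 ^^ (2 * n - 4)) \<rho> \<in> Av n {[1, 3, 2], [2, 3, 1]})"
proof -
  let ?A = "Av 11 {[1, 3, 2], [2, 3, 1]}"
  have eleven: "{1..11::nat} = {1, 2, 3, 4, 5, 6, 7, 8, 9, 10, 11}"
    by (auto simp: atLeastAtMostSuc_conv numeral_eq_Suc)
  have perm: "\<pi> \<in> Perms 11"
    unfolding assms eleven permutations_of_set_def by auto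
  have it18: "(SC231 ^^ 18) \<pi> = [8, 7, 4, 3, 2, 1, 5, 6, 9, 11, 10]"
    unfolding assms by (rule SC231_pow_18)
  have "subseq [9, 11, 10] ((SC231 ^^ 18) \<pi>)"
    unfolding it18 by simp
  then have "\<not> peak_free ((SC231 ^^ 18) \<pi>)"
    unfolding peak_free_def by fastforce
  then have notin18: "(SC231 ^^ 18) \<pi> \<notin> ?A"
    by (simp only: Av_132_231_iff) simp
  have "(SC231 ^^ 19) \<pi> = SC231 ((SC231 ^^ 18) \<pi>)"
    using funpow.simps(2)[of 18 SC231] by simp
  then have it19: "(SC231 ^^ 19) \<pi> = [11, 10, 9, 6, 5, 1, 2, 3, 4, 7, 8]"
    by (simp only: it18 SC231_step_19)
  have "peak_free ([11, 10, 9, 6, 5, 1] @ [2, 3, 4, 7, 8::nat])"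
    by (rule peak_free_decreasing_increasing) simp_all
  moreover have "(SC231 ^^ 19) \<pi> \<in> Perms 11"
    unfolding it19 eleven permutations_of_set_def by auto
  ultimately have in19: "(SC231 ^^ 19) \<pi> \<in> ?A"
    by (simp only: Av_132_231_iff it19) simp
  have early: "\<not> periodic_point SC231 ((SC231 ^^ m) \<pi>) \<and> (SC231 ^^ m) \<pi> \<notin> ?A"
    if "m < 19" for m
  proof -
    \<comment> \<open>An earlier avoider would make the iterate 18 an avoider as well.\<close>
    have notin: "(SC231 ^^ m) \<pi> \<notin> ?A"
      using funpow_closed_mono[of ?A SC231 m \<pi> 18] SC231_Av notin18 that by auto
    have "(SC231 ^^ (19 - m)) ((SC231 ^^ m) \<pi>) = (SC231 ^^ 19) \<pi>"
      using that funpow_add[of "19 - m" m SC231] by (simp add: o_def fun_eq_iff)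
    then have "(SC231 ^^ (19 - m)) ((SC231 ^^ m) \<pi>) \<in> ?A"
      using in19 by simp
    then have "periodic_point SC231 ((SC231 ^^ m) \<pi>) \<Longrightarrow> (SC231 ^^ m) \<pi> \<in> ?A"
      by (metis (no_types, lifting) SC231_Av periodic_point_absorbed)
    then show ?thesis using notin by blast
  qed
  have "\<not> (\<forall>n\<ge>3. \<forall>\<rho>\<in>Perms n. (SC231 ^^ (2 * n - 4)) \<rho> \<in> Av n {[1, 3, 2], [2, 3, 1]})"
  proof
    assume "\<forall>n\<ge>3. \<forall>\<rho>\<in>Perms n. (SC231 ^^ (2 * n - 4)) \<rho> \<in> Av n {[1, 3, 2], [2, 3, 1]}"
    then have "(SC231 ^^ (2 * 11 - 4)) \<pi> \<in> ?A"
      using perm by (elim allE[of _ 11]) auto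
    then show False using notin18 by simp
  qed
  then show ?thesis
    using perm early notin18 in19 periodic_point_Av[OF in19] by blast
qed

end
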